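(* Let $G=(V,E)$ be a finite undirected loopless graph (parallel edges allowed) that has a strongly connected orientation. A strongly connected orientation $D$ of $G$ is decreasingly minimal (among strongly connected orientations of $G$) if and only if there are no nodes $s,t$ with $\varrho_D(t)\ge\varrho_D(s)+2$ such that $D$ contains two arc-disjoint directed paths from $s$ to $t$.
   Context: $\varrho_D(v)$ is the in-degree of $v$ in $D$. An orientation is decreasingly minimal among a family of orientations if its in-degree vector, sorted in decreasing order, is lexicographically smaller than or equal to that of every member of the family sorted likewise. *)

theory Defs
  imports "Graph_Theory.Graph_Theory" "HOL-Library.Multiset"
begin

text \<open>Edges are abstract elements of \<open>'b\<close> carrying a set of two end-nodes, so distinct
  edges may be parallel.\<close>

record ('a, 'b) multigraph =
  nodes :: "'a set"
  edges :: "'b set"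
  ends :: "'b \<Rightarrow> 'a set"

locale fin_loopless_multigraph =
  fixes G :: "('a, 'b) multigraph"
  assumes finite_nodes: "finite (nodes G)"
    and finite_edges: "finite (edges G)"
    and ends_in_nodes: "e \<in> edges G \<Longrightarrow> ends G e \<subseteq> nodes G"
    and card_ends: "e \<in> edges G \<Longrightarrow> card (ends G e) = 2"

definition orientation_of :: "('a, 'b) pre_digraph \<Rightarrow> ('a, 'b) multigraph \<Rightarrow> bool" where
  "orientation_of D G \<longleftrightarrow>
     verts D = nodes G \<and> arcs D = edges G \<and>
     (\<forall>e \<in> edges G. {tail D e, head D e} = ends G e)"

definition strong_orientations :: "('a, 'b) multigraph \<Rightarrow> ('a, 'b) pre_digraph set" where
  "strong_orientations G = {D. orientation_of D G \<and> strongly_connected D}"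

definition sorted_in_degrees :: "('a, 'b) pre_digraph \<Rightarrow> nat list" where
  "sorted_in_degrees D =
     rev (sorted_list_of_multiset (image_mset (in_degree D) (mset_set (verts D))))"

definition dec_min_among ::
    "('a, 'b) pre_digraph \<Rightarrow> ('a, 'b) pre_digraph set \<Rightarrow> bool" where
  "dec_min_among D F \<longleftrightarrow>
     D \<in> F \<and>
     (\<forall>D' \<in> F. sorted_in_degrees D = sorted_in_degrees D' \<or>
        (sorted_in_degrees D, sorted_in_degrees D') \<in> lexord {(a, b). a < b})"

definition two_arc_disjoint_paths :: "('a, 'b) pre_digraph \<Rightarrow> 'a \<Rightarrow> 'a \<Rightarrow> bool" where
  "two_arc_disjoint_paths D s t \<longleftrightarrow>
     (\<exists>p q. p \<noteq> q \<and> pre_digraph.apath D s p t \<and> pre_digraph.apath D s q t \<and> set p \<inter> set q = {})"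

end

theory Submission
  imports Defs
begin

text \<open>Two arc-disjoint paths from \<open>s\<close> to \<open>t\<close> exist exactly when
  every node set containing \<open>s\<close> but not \<open>t\<close> has at least two leaving arcs
  (\<open>two_arc_disjoint_paths_iff_leaving\<close>). Reversing a single path from \<open>s\<close>
  to \<open>t\<close> shrinks only those cuts, each by one, so strong connectivity survives, while
  one unit of in-degree moves from \<open>t\<close> to \<open>s\<close>. If the in-degrees differ by
  at least 2, the sorted vector drops strictly; hence a decreasingly minimal orientation has no such
  pair (\<open>dec_min_no_transfer\<close>).

  Conversely, the in-degree vectors of strong orientations obey an exchange property like that of
  integral base polyhedra (\<open>strong_orientation_exchange\<close>): a surplus of
  \<open>D\<close> over \<open>D'\<close> at \<open>t\<close> is matched by a deficit at some
  \<open>s\<close> from which two arc-disjoint paths lead to \<open>t\<close> in \<open>D\<close>.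
  Let \<open>D\<close> have no improving pair, and let \<open>D'\<close> be decreasingly minimal
  with in-degrees as near as possible to those of \<open>D\<close>. If they differed, exchanges in
  \<open>D\<close> and then in \<open>D'\<close> would give a move in \<open>D'\<close> that keeps
  the sorted vector but comes nearer to \<open>D\<close>. So the in-degrees agree and
  \<open>D\<close> is minimal too (\<open>dec_min_if_no_transfer\<close>).\<close>

section \<open>Cuts, path reversal and Menger's theorem for two paths\<close>

definition leaving :: "('a, 'b) pre_digraph \<Rightarrow> 'a set \<Rightarrow> 'b set" where
  "leaving D C = {e \<in> arcs D. tail D e \<in> C \<and> head D e \<notin> C}"

definition reverse_arcs :: "('a, 'b) pre_digraph \<Rightarrow> 'b set \<Rightarrow> ('a, 'b) pre_digraph" where
  "reverse_arcs D P = D\<lparr>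
     tail := (\<lambda>e. if e \<in> P then head D e else tail D e),
     head := (\<lambda>e. if e \<in> P then tail D e else head D e)\<rparr>"

lemma reverse_arcs_simps [simp]:
  "verts (reverse_arcs D P) = verts D"
  "arcs (reverse_arcs D P) = arcs D"
  "tail (reverse_arcs D P) e = (if e \<in> P then head D e else tail D e)"
  "head (reverse_arcs D P) e = (if e \<in> P then tail D e else head D e)"
  by (simp_all add: reverse_arcs_def)

lemma orientation_of_reverse_arcs:
  "orientation_of D G \<Longrightarrow> orientation_of (reverse_arcs D P) G"
  by (auto simp: orientation_of_def)

text \<open>Integer-valued sums of indicators allow subtraction, so reversal and submodularity can
  be checked arc by arc.\<close>

lemma card_leaving_conv_sum:
  "finite (arcs D) \<Longrightarrow>
    int (card (leaving D C)) = (\<Sum>e\<in>arcs D. of_bool (tail D e \<in> C \<and> head D e \<notin> C))"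
  by (simp add: leaving_def Int_def flip: of_nat_sum)

lemma in_degree_conv_sum:
  "finite (arcs D) \<Longrightarrow> int (in_degree D v) = (\<Sum>e\<in>arcs D. of_bool (head D e = v))"
  by (simp add: in_degree_def in_arcs_def Int_def flip: of_nat_sum)

lemma sum_in_degree:
  assumes "finite Z" "finite (arcs D)"
  shows "(\<Sum>v\<in>Z. in_degree D v) = card {e \<in> arcs D. head D e \<in> Z}"
proof -
  have "{e \<in> arcs D. head D e \<in> Z} = (\<Union>v\<in>Z. in_arcs D v)"
    by (auto simp: in_arcs_def)
  moreover have "card (\<Union>v\<in>Z. in_arcs D v) = (\<Sum>v\<in>Z. card (in_arcs D v))"
    using assms by (intro card_UN_disjoint) (auto simp: in_arcs_def)
  ultimately show ?thesis by (simp add: in_degree_def)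
qed

text \<open>The sum telescopes along the walk: entries into \<open>Z\<close> minus exits from
  \<open>Z\<close>.\<close>

lemma (in pre_digraph) cas_net:
  "cas u p v \<Longrightarrow> (\<Sum>e\<leftarrow>p. of_bool (head G e \<in> Z) - of_bool (tail G e \<in> Z)) =
    (of_bool (v \<in> Z) - of_bool (u \<in> Z) :: int)"
  by (induct u p v rule: cas.induct) auto

lemma (in pre_digraph) apath_net:
  assumes "apath u p v"
  shows "(\<Sum>e\<in>set p. of_bool (head G e \<in> Z) - of_bool (tail G e \<in> Z)) =
    (of_bool (v \<in> Z) - of_bool (u \<in> Z) :: int)"
proof -
  from assms have "distinct p"
    by (auto simp: apath_def awalk_verts_conv distinct_map split: if_splits)
  moreover from assms have "cas u p v" by (simp add: apath_def awalk_def)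
  ultimately show ?thesis
    using cas_net[of u p v Z] by (simp only: sum_list_distinct_conv_sum_set)
qed

text \<open>The net number of entries into \<open>C\<close> along the path is -1, so some summand is
  negative, and such an arc leaves \<open>C\<close>.\<close>

lemma (in pre_digraph) apath_leaves:
  assumes "apath u p v" "u \<in> C" "v \<notin> C"
  shows "\<exists>e\<in>set p. e \<in> leaving G C"
proof (rule ccontr)
  assume *: "\<not> ?thesis"
  have "set p \<subseteq> arcs G" using assms by (simp add: apath_def awalk_def)
  with * have "0 \<le> (\<Sum>e\<in>set p. of_bool (head G e \<in> C) - of_bool (tail G e \<in> C) :: int)"
    by (intro sum_nonneg) (auto simp: leaving_def)
  with assms show False by (simp add: apath_net)
qed

text \<open>The nodes reachable from \<open>s\<close> through \<open>A\<close> form a set that no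
  arc of \<open>A\<close> leaves; if it missed \<open>t\<close>, it would violate the cut
  condition.\<close>

lemma (in wf_digraph) apath_within_if_cuts:
  assumes A: "A \<subseteq> arcs G" and s: "s \<in> verts G" and t: "t \<in> verts G"
    and cut: "\<And>C. C \<subseteq> verts G \<Longrightarrow> s \<in> C \<Longrightarrow> t \<notin> C \<Longrightarrow> A \<inter> leaving G C \<noteq> {}"
  shows "\<exists>p. apath s p t \<and> set p \<subseteq> A"
proof -
  define H where "H = G\<lparr>arcs := A\<rparr>"
  interpret H: wf_digraph H
    using A by unfold_locales (auto simp: H_def)
  have sub: "subgraph H G"
    using A wf_digraph H.wf_digraph
    by (auto simp: subgraph_def compatible_def H_def)
  let ?C = "{v. s \<rightarrow>\<^sup>*\<^bsub>H\<^esub> v}"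
  have "t \<in> ?C"
  proof (rule ccontr)
    assume "t \<notin> ?C"
    moreover have "?C \<subseteq> verts G" using H.reachable_in_verts(2) by (auto simp: H_def)
    moreover have "s \<in> verts H" using s by (simp add: H_def)
    then have "s \<in> ?C" by simp
    ultimately obtain e where e: "e \<in> A" "s \<rightarrow>\<^sup>*\<^bsub>H\<^esub> tail G e" "\<not> s \<rightarrow>\<^sup>*\<^bsub>H\<^esub> head G e"
      using cut[of ?C] by (auto simp: leaving_def)
    then have "tail G e \<rightarrow>\<^bsub>H\<^esub> head G e"
      using H.in_arcs_imp_in_arcs_ends[of e] by (simp add: H_def)
    with e show False using H.reachable_adj_trans by blast
  qed
  then obtain p where p: "H.apath s p t" using H.reachable_apath by auto
  then have "set p \<subseteq> A" by (auto simp: H.apath_def H.awalk_def) (simp add: H_def subset_iff)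
  with p sub show ?thesis using subgraph_apath_imp_apath by blast
qed

lemma (in wf_digraph) strongly_connected_iff_leaving:
  "strongly_connected G \<longleftrightarrow> verts G \<noteq> {} \<and>
    (\<forall>C\<subseteq>verts G. C \<noteq> {} \<longrightarrow> C \<noteq> verts G \<longrightarrow> leaving G C \<noteq> {})" (is "?L \<longleftrightarrow> ?R")
proof
  assume ?L
  have "leaving G C \<noteq> {}" if C: "C \<subseteq> verts G" "C \<noteq> {}" "C \<noteq> verts G" for C
  proof -
    obtain u v where uv: "u \<in> C" "v \<in> verts G - C" using C by blast
    then obtain p where "apath u p v"
      using \<open>?L\<close> C unfolding strongly_connected_def reachable_apath by blast
    with uv show ?thesis using apath_leaves[of u p v C] by auto
  qed
  with \<open>?L\<close> show ?R by (auto simp: strongly_connected_def)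
next
  assume R: ?R
  have "u \<rightarrow>\<^sup>* v" if "u \<in> verts G" "v \<in> verts G" for u v
  proof -
    have "arcs G \<inter> leaving G C \<noteq> {}" if "C \<subseteq> verts G" "u \<in> C" "v \<notin> C" for C
      using R that \<open>v \<in> verts G\<close> by (auto simp: leaving_def)
    then show ?thesis
      using apath_within_if_cuts[of "arcs G" u v] that reachable_apath by auto
  qed
  with R show ?L by (auto simp: strongly_connected_def)
qed

text \<open>Only path arcs change, and their signed contributions add up by
  \<open>apath_net\<close>: the set \<open>{v}\<close> gives the in-degree, the set \<open>C\<close>
  the cut.\<close>

lemma (in fin_digraph) reverse_apath:
  assumes p: "apath s p t"
  shows in_degree_reverse_apath:
      "int (in_degree (reverse_arcs G (set p)) v) =
        int (in_degree G v) + of_bool (v = s) - of_bool (v = t)"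
    and card_leaving_reverse_apath:
      "int (card (leaving (reverse_arcs G (set p)) C)) =
        int (card (leaving G C)) + of_bool (t \<in> C) - of_bool (s \<in> C)"
proof -
  have sub: "set p \<subseteq> arcs G" using p by (simp add: apath_def awalk_def)
  let ?n = "\<lambda>Z e. of_bool (head G e \<in> Z) - of_bool (tail G e \<in> Z) :: int"
  have n: "(\<Sum>e\<in>arcs G. if e \<in> set p then ?n Z e else 0) = of_bool (t \<in> Z) - of_bool (s \<in> Z)" for Z
    using sub apath_net[OF p, of Z]
    by (simp add: sum.inter_restrict[symmetric] Int_absorb1)
  have "int (in_degree (reverse_arcs G (set p)) v) =
      (\<Sum>e\<in>arcs G. of_bool (head G e = v) - (if e \<in> set p then ?n {v} e else 0))"
    by (subst in_degree_conv_sum, simp, intro sum.cong) auto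
  then show "int (in_degree (reverse_arcs G (set p)) v) =
        int (in_degree G v) + of_bool (v = s) - of_bool (v = t)"
    by (simp only: sum_subtractf n in_degree_conv_sum finite_arcs) auto
  have "int (card (leaving (reverse_arcs G (set p)) C)) =
      (\<Sum>e\<in>arcs G. of_bool (tail G e \<in> C \<and> head G e \<notin> C) + (if e \<in> set p then ?n C e else 0))"
    by (subst card_leaving_conv_sum, simp, intro sum.cong) auto
  then show "int (card (leaving (reverse_arcs G (set p)) C)) =
        int (card (leaving G C)) + of_bool (t \<in> C) - of_bool (s \<in> C)"
    by (simp only: sum.distrib n card_leaving_conv_sum finite_arcs)
qed

lemma (in fin_digraph) fin_digraph_reverse_arcs: "fin_digraph (reverse_arcs G P)"
  by unfold_locales auto

text \<open>The case \<open>k = 2\<close> of Menger's theorem. Reversing one path \<open>p\<close> lowers each cut by one, so a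
  second path \<open>q\<close> remains; the symmetric difference of \<open>p\<close> and \<open>q\<close> is then a flow of
  value 2, from which two paths are removed one after the other.\<close>

lemma (in fin_digraph) two_arc_disjoint_paths_iff_leaving:
  assumes s: "s \<in> verts G" and t: "t \<in> verts G" and st: "s \<noteq> t"
  shows "two_arc_disjoint_paths G s t \<longleftrightarrow>
    (\<forall>C\<subseteq>verts G. s \<in> C \<longrightarrow> t \<notin> C \<longrightarrow> card (leaving G C) \<ge> 2)" (is "?L \<longleftrightarrow> ?R")
proof
  assume ?L
  then obtain p q where pq: "apath s p t" "apath s q t" "set p \<inter> set q = {}"
    by (auto simp: two_arc_disjoint_paths_def)
  show ?R
  proof (intro allI impI)
    fix C assume C: "C \<subseteq> verts G" "s \<in> C" "t \<notin> C"
    obtain e f where ef: "e \<in> set p" "e \<in> leaving G C" "f \<in> set q" "f \<in> leaving G C"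
      using apath_leaves[OF pq(1) C(2,3)] apath_leaves[OF pq(2) C(2,3)] by auto
    with pq have "e \<noteq> f" by auto
    then have "2 = card {e, f}" by simp
    also have "\<dots> \<le> card (leaving G C)"
      using ef by (intro card_mono) (auto simp: leaving_def)
    finally show "card (leaving G C) \<ge> 2" .
  qed
next
  assume R: ?R
  let ?n = "\<lambda>C e. of_bool (head G e \<in> C) - of_bool (tail G e \<in> C) :: int"
  \<comment> \<open>A negative net inflow into \<open>C\<close> forces an arc of \<open>A\<close> to
    leave \<open>C\<close>, so net values alone supply the cut condition.\<close>
  have flow: "\<exists>p. apath s p t \<and> set p \<subseteq> A"
    if A: "A \<subseteq> arcs G"
      and neg: "\<And>C. s \<in> C \<Longrightarrow> t \<notin> C \<Longrightarrow> (\<Sum>e\<in>A. ?n C e) < 0" for A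
  proof (rule apath_within_if_cuts[OF A s t])
    fix C assume C: "s \<in> C" "t \<notin> C"
    show "A \<inter> leaving G C \<noteq> {}"
    proof
      assume "A \<inter> leaving G C = {}"
      then have "0 \<le> (\<Sum>e\<in>A. ?n C e)"
        using A by (intro sum_nonneg) (auto simp: leaving_def)
      with neg[OF C] show False by simp
    qed
  qed
  have "arcs G \<inter> leaving G C \<noteq> {}" if "C \<subseteq> verts G" "s \<in> C" "t \<notin> C" for C
  proof -
    have "2 \<le> card (leaving G C)" using R that by blast
    then have "leaving G C \<noteq> {}" by auto
    then show ?thesis by (auto simp: leaving_def)
  qed
  then obtain p where p: "apath s p t" using apath_within_if_cuts[of "arcs G" s t] s t by auto
  define H where "H = reverse_arcs G (set p)"
  interpret H: fin_digraph H unfolding H_def by (rule fin_digraph_reverse_arcs)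
  have "arcs H \<inter> leaving H C \<noteq> {}" if "C \<subseteq> verts H" "s \<in> C" "t \<notin> C" for C
  proof -
    have "int (card (leaving H C)) = int (card (leaving G C)) - 1"
      using card_leaving_reverse_apath[OF p, of C] that by (simp add: H_def)
    moreover have "card (leaving G C) \<ge> 2" using R that by (simp add: H_def)
    ultimately have "card (leaving H C) \<noteq> 0" by linarith
    then have "leaving H C \<noteq> {}" by auto
    then show ?thesis by (auto simp: leaving_def)
  qed
  then obtain q where q: "H.apath s q t"
    using H.apath_within_if_cuts[of "arcs H" s t] s t by (auto simp: H_def)
  have sub: "set p \<subseteq> arcs G" "set q \<subseteq> arcs G"
    using p q unfolding apath_def awalk_def H.apath_def H.awalk_def by (simp_all add: H_def)
  define A where "A = (set p - set q) \<union> (set q - set p)"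
  have netA: "(\<Sum>e\<in>A. ?n C e) = 2 * (of_bool (t \<in> C) - of_bool (s \<in> C))" for C
  proof -
    define n where "n = ?n C"
    \<comment> \<open>An arc of \<open>p\<close> points the other way in \<open>H\<close>, so
      \<open>q\<close> traverses it backwards and its contribution changes sign. Hence the arcs
      common to both paths cancel.\<close>
    have "of_bool (t \<in> C) - of_bool (s \<in> C) = (\<Sum>e\<in>set q. if e \<in> set p then - n e else n e)"
      unfolding H.apath_net[OF q, of C, symmetric] by (intro sum.cong) (auto simp: H_def n_def)
    also have "\<dots> = (\<Sum>e\<in>set q \<inter> set p. - n e) + sum n (set q - set p)"
      by (subst sum.If_cases) (auto simp: Diff_eq)
    also have "\<dots> = sum n (set q - set p) - sum n (set q \<inter> set p)" by (simp add: sum_negf)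
    finally have "sum n (set q - set p) =
      of_bool (t \<in> C) - of_bool (s \<in> C) + sum n (set q \<inter> set p)" by simp
    moreover have "sum n (set p) = sum n (set q \<inter> set p) + sum n (set p - set q)"
      by (subst sum.Int_Diff[of _ _ "set q"]) (auto simp: Int_commute)
    moreover have "sum n (set p) = of_bool (t \<in> C) - of_bool (s \<in> C)"
      using apath_net[OF p, of C] by (simp add: n_def)
    moreover have "sum n A = sum n (set p - set q) + sum n (set q - set p)"
      unfolding A_def by (intro sum.union_disjoint) auto
    ultimately have "sum n A = 2 * (of_bool (t \<in> C) - of_bool (s \<in> C))" by simp
    then show ?thesis by (simp only: n_def)
  qed
  have A: "A \<subseteq> arcs G" "finite A" using sub by (auto simp: A_def)
  obtain p1 where p1: "apath s p1 t" "set p1 \<subseteq> A"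
    using flow[OF A(1)] netA by auto
  have "(\<Sum>e\<in>A - set p1. ?n C e) = of_bool (t \<in> C) - of_bool (s \<in> C)" for C
    using sum.subset_diff[OF p1(2) A(2), of "?n C"] netA[of C] apath_net[OF p1(1), of C] by simp
  then obtain p2 where p2: "apath s p2 t" "set p2 \<subseteq> A - set p1"
    using flow[of "A - set p1"] A by (auto simp: subset_iff)
  \<comment> \<open>Disjoint arc lists can coincide only if both are empty, and an empty path would
    force \<open>s = t\<close>.\<close>
  have "p1 \<noteq> []" using p1 st by (auto simp: apath_Nil_iff)
  moreover have "set p1 \<inter> set p2 = {}" using p2 by auto
  ultimately have "p1 \<noteq> p2" by auto
  with p1 p2 \<open>set p1 \<inter> set p2 = {}\<close> show ?L by (auto simp: two_arc_disjoint_paths_def)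
qed

section \<open>Exchange and path reversal for strong orientations\<close>

lemma card_leaving_submodular:
  assumes "finite (arcs D)"
  shows "card (leaving D (C1 \<union> C2)) + card (leaving D (C1 \<inter> C2)) \<le>
    card (leaving D C1) + card (leaving D C2)"
proof -
  have "int (card (leaving D (C1 \<union> C2))) + int (card (leaving D (C1 \<inter> C2))) \<le>
      int (card (leaving D C1)) + int (card (leaving D C2))"
    unfolding card_leaving_conv_sum[OF assms] sum.distrib[symmetric]
    by (intro sum_mono) auto
  then show ?thesis by linarith
qed

context fin_loopless_multigraph
begin

lemma fin_digraph_orientation:
  assumes "orientation_of D G"
  shows "fin_digraph D"
proof
  fix e assume e: "e \<in> arcs D"
  with assms have "{tail D e, head D e} = ends G e" "ends G e \<subseteq> verts D"
    using ends_in_nodes[of e] by (auto simp: orientation_of_def)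
  then show "tail D e \<in> verts D" "head D e \<in> verts D" by auto
qed (use assms finite_nodes finite_edges in \<open>auto simp: orientation_of_def\<close>)

text \<open>An edge meeting \<open>C\<close> either has its head in \<open>C\<close> or leaves
  \<open>C\<close>, never both. The total depends on the graph alone, so a smaller cut means a
  larger in-degree sum.\<close>

lemma sum_in_degree_plus_leaving:
  assumes D: "orientation_of D G" and C: "C \<subseteq> nodes G"
  shows "(\<Sum>v\<in>C. in_degree D v) + card (leaving D C) = card {e \<in> edges G. ends G e \<inter> C \<noteq> {}}"
proof -
  interpret fin_digraph D by (rule fin_digraph_orientation[OF D])
  have "finite C" using C finite_nodes by (rule finite_subset)
  then have "(\<Sum>v\<in>C. in_degree D v) = card {e \<in> arcs D. head D e \<in> C}"
    by (simp add: sum_in_degree)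
  moreover have "card ({e \<in> arcs D. head D e \<in> C} \<union> leaving D C) =
      card {e \<in> arcs D. head D e \<in> C} + card (leaving D C)"
    by (intro card_Un_disjoint) (auto simp: leaving_def)
  moreover have "{e \<in> arcs D. head D e \<in> C} \<union> leaving D C = {e \<in> edges G. ends G e \<inter> C \<noteq> {}}"
  proof -
    have "arcs D = edges G" and "\<And>e. e \<in> edges G \<Longrightarrow> ends G e = {tail D e, head D e}"
      using D by (auto simp: orientation_of_def)
    then show ?thesis by (auto simp: leaving_def)
  qed
  ultimately show ?thesis by simp
qed

text \<open>Sets \<open>C\<close> with a single leaving arc that avoid \<open>t\<close> have the largest possible in-degree sum
  among strong orientations. By submodularity the maximal ones are disjoint, so the same holds for
  their union; outside of it, every \<open>s\<close> satisfies the cut condition towards \<open>t\<close>.\<close>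

lemma strong_orientation_exchange:
  assumes D: "D \<in> strong_orientations G" and D': "D' \<in> strong_orientations G"
    and t: "t \<in> nodes G" and less: "in_degree D' t < in_degree D t"
  obtains s where "s \<in> nodes G" "in_degree D s < in_degree D' s" "two_arc_disjoint_paths D s t"
proof -
  have oD: "orientation_of D G" and oD': "orientation_of D' G"
    and sc: "strongly_connected D" "strongly_connected D'"
    using D D' by (auto simp: strong_orientations_def)
  interpret D: fin_digraph D by (rule fin_digraph_orientation[OF oD])
  interpret D': fin_digraph D' by (rule fin_digraph_orientation[OF oD'])
  have V: "verts D = nodes G" "verts D' = nodes G" using oD oD' by (auto simp: orientation_of_def)
  have pos: "card (leaving D C) \<ge> 1" "card (leaving D' C) \<ge> 1"
    if "C \<subseteq> nodes G" "C \<noteq> {}" "t \<notin> C" for C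
  proof -
    have "leaving D C \<noteq> {}" "leaving D' C \<noteq> {}"
      using sc that t unfolding D.strongly_connected_iff_leaving D'.strongly_connected_iff_leaving V
      by auto
    moreover have "finite (leaving D C)" "finite (leaving D' C)" by (auto simp: leaving_def)
    ultimately show "card (leaving D C) \<ge> 1" "card (leaving D' C) \<ge> 1"
      by (auto simp: Suc_le_eq card_gt_0_iff)
  qed
  define T where "T = {C. C \<subseteq> nodes G \<and> C \<noteq> {} \<and> t \<notin> C \<and> card (leaving D C) = 1}"
  have finT: "finite T"
    by (rule finite_subset[of _ "Pow (nodes G)"]) (auto simp: T_def finite_nodes)
  have T_le: "(\<Sum>v\<in>C. in_degree D' v) \<le> (\<Sum>v\<in>C. in_degree D v)" if "C \<in> T" for C
    using sum_in_degree_plus_leaving[OF oD, of C] sum_in_degree_plus_leaving[OF oD', of C]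
      pos(2)[of C] that by (simp add: T_def)
  \<comment> \<open>Both the union and the nonempty intersection avoid \<open>t\<close>, so each has
    a leaving arc; a total of at most 2 leaves exactly one for each.\<close>
  have T_Un: "A \<union> B \<in> T" if "A \<in> T" "B \<in> T" "A \<inter> B \<noteq> {}" for A B
  proof -
    have "card (leaving D (A \<union> B)) + card (leaving D (A \<inter> B)) \<le> 2"
      using card_leaving_submodular[of D A B] that by (simp add: T_def)
    moreover have "card (leaving D (A \<union> B)) \<ge> 1" "card (leaving D (A \<inter> B)) \<ge> 1"
      using that by (intro pos(1); auto simp: T_def)+
    ultimately show ?thesis using that by (auto simp: T_def)
  qed
  define M where "M = {C \<in> T. \<forall>B\<in>T. C \<subseteq> B \<longrightarrow> C = B}"
  have "\<Union>T \<subseteq> \<Union>M"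
  proof
    fix x assume "x \<in> \<Union>T"
    then obtain A where A: "A \<in> T" "x \<in> A" by auto
    then obtain B where "B \<in> T" "A \<subseteq> B" "\<forall>C\<in>T. B \<subseteq> C \<longrightarrow> B = C"
      using finite_has_maximal2[OF finT A(1)] by auto
    with A show "x \<in> \<Union>M" by (auto simp: M_def)
  qed
  then have UM: "\<Union>M = \<Union>T" by (auto simp: M_def)
  have disj: "A \<inter> B = {}" if "A \<in> M" "B \<in> M" "A \<noteq> B" for A B
  proof (rule ccontr)
    assume "A \<inter> B \<noteq> {}"
    with that have "A \<union> B \<in> T" by (auto simp: M_def intro: T_Un)
    with that have "A = A \<union> B" "B = A \<union> B" by (auto simp: M_def)
    with that show False by simp
  qed
  have finM: "\<forall>A\<in>M. finite A"
    using finite_nodes by (auto simp: M_def T_def intro: finite_subset)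
  have "(\<Sum>v\<in>\<Union>T. in_degree D' v) \<le> (\<Sum>v\<in>\<Union>T. in_degree D v)"
    unfolding UM[symmetric] using finM disj
    by (simp add: sum.Union_disjoint) (auto intro!: sum_mono T_le simp: M_def)
  moreover have "(\<Sum>v\<in>nodes G. in_degree D' v) = (\<Sum>v\<in>nodes G. in_degree D v)"
  proof -
    have "leaving D (nodes G) = {}" "leaving D' (nodes G) = {}"
      by (auto simp: leaving_def simp flip: V(1)) (auto simp: V simp flip: V(2))
    then show ?thesis
      using sum_in_degree_plus_leaving[OF oD order_refl] sum_in_degree_plus_leaving[OF oD' order_refl]
      by simp
  qed
  moreover have UT: "\<Union>T \<subseteq> nodes G" by (auto simp: T_def)
  note sum.subset_diff[OF UT finite_nodes, of "in_degree D"]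
    sum.subset_diff[OF UT finite_nodes, of "in_degree D'"]
  ultimately have le: "(\<Sum>v\<in>nodes G - \<Union>T. in_degree D v) \<le> (\<Sum>v\<in>nodes G - \<Union>T. in_degree D' v)"
    by linarith
  \<comment> \<open>Outside \<open>\<Union>T\<close>, \<open>D'\<close> has at least the in-degree
    sum of \<open>D\<close>. Since \<open>t\<close> lies there and has less in \<open>D'\<close>,
    another node must have more.\<close>
  have "\<exists>s\<in>nodes G - \<Union>T. in_degree D s < in_degree D' s"
  proof (rule ccontr)
    assume "\<not> ?thesis"
    then have "(\<Sum>v\<in>nodes G - \<Union>T. in_degree D' v) < (\<Sum>v\<in>nodes G - \<Union>T. in_degree D v)"
      using finite_nodes t less
      by (intro sum_strict_mono_ex1) (auto simp: T_def not_less intro!: bexI[of _ t])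
    with le show False by simp
  qed
  then obtain s where s: "s \<in> nodes G" "s \<notin> \<Union>T" "in_degree D s < in_degree D' s" by auto
  have "two_arc_disjoint_paths D s t"
  proof (subst D.two_arc_disjoint_paths_iff_leaving)
    show "s \<noteq> t" using s less by auto
    show "\<forall>C\<subseteq>verts D. s \<in> C \<longrightarrow> t \<notin> C \<longrightarrow> 2 \<le> card (leaving D C)"
    proof (intro allI impI)
      fix C assume C: "C \<subseteq> verts D" "s \<in> C" "t \<notin> C"
      then have "C \<notin> T" using s by auto
      moreover have "C \<noteq> {}" using C by auto
      ultimately show "2 \<le> card (leaving D C)" using C pos(1)[of C] by (simp add: T_def V)
    qed
  qed (use s t V in auto)
  with s that show ?thesis by blast
qed

text \<open>Only cuts separating \<open>s\<close> from \<open>t\<close> lose an arc, and by the easy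
  half of Menger these had at least two. One path is reversed; the other only certifies the
  cuts.\<close>

lemma strong_orientation_reverse_path:
  assumes D: "D \<in> strong_orientations G" and paths: "two_arc_disjoint_paths D s t"
    and st: "s \<in> nodes G" "t \<in> nodes G" "s \<noteq> t"
  obtains D' where "D' \<in> strong_orientations G"
    "\<And>v. int (in_degree D' v) = int (in_degree D v) + of_bool (v = s) - of_bool (v = t)"
proof -
  have oD: "orientation_of D G" and sc: "strongly_connected D"
    using D by (auto simp: strong_orientations_def)
  interpret D: fin_digraph D by (rule fin_digraph_orientation[OF oD])
  have V: "verts D = nodes G" using oD by (auto simp: orientation_of_def)
  obtain p where p: "D.apath s p t" using paths by (auto simp: two_arc_disjoint_paths_def)
  define D' where "D' = reverse_arcs D (set p)"
  interpret D': fin_digraph D' unfolding D'_def by (rule D.fin_digraph_reverse_arcs)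
  have "leaving D' C \<noteq> {}" if C: "C \<subseteq> nodes G" "C \<noteq> {}" "C \<noteq> nodes G" for C
  proof -
    have "leaving D C \<noteq> {}"
      using sc C unfolding D.strongly_connected_iff_leaving V by auto
    then have "card (leaving D C) \<ge> 1"
      by (auto simp: Suc_le_eq card_gt_0_iff) (auto simp: leaving_def)
    moreover have "card (leaving D C) \<ge> 2" if "s \<in> C" "t \<notin> C"
      using paths st C that D.two_arc_disjoint_paths_iff_leaving[of s t] by (auto simp: V)
    moreover have "int (card (leaving D' C)) =
        int (card (leaving D C)) + of_bool (t \<in> C) - of_bool (s \<in> C)"
      unfolding D'_def by (rule D.card_leaving_reverse_apath[OF p])
    ultimately have "card (leaving D' C) \<noteq> 0"
      by (cases "s \<in> C"; cases "t \<in> C") auto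
    then show ?thesis by auto
  qed
  then have "strongly_connected D'"
    using sc unfolding D'.strongly_connected_iff_leaving
    by (auto simp: D'_def V strongly_connected_def)
  moreover have "orientation_of D' G"
    unfolding D'_def by (rule orientation_of_reverse_arcs[OF oD])
  ultimately have "D' \<in> strong_orientations G" by (simp add: strong_orientations_def)
  then show thesis
    using that D.in_degree_reverse_apath[OF p] by (auto simp: D'_def)
qed

end

section \<open>Sorted in-degree vectors under transfer of one unit\<close>

definition desc_list :: "nat multiset \<Rightarrow> nat list" where
  "desc_list M = rev (sorted_list_of_multiset M)"

lemma desc_list_add:
  assumes "\<And>x y. x \<in># A \<Longrightarrow> y \<in># B \<Longrightarrow> y \<le> x"
  shows "desc_list (A + B) = desc_list A @ desc_list B"
proof -
  let ?xs = "sorted_list_of_multiset B @ sorted_list_of_multiset A"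
  have "sorted ?xs" using assms by (auto simp: sorted_append)
  then have "sorted_list_of_multiset (mset ?xs) = ?xs"
    by (simp only: sorted_list_of_multiset_mset sorted_sort_id)
  then show ?thesis by (simp add: desc_list_def add.commute)
qed

text \<open>The entries of \<open>M\<close> that are at least \<open>a\<close> form a common prefix.
  After it the old list continues with \<open>a\<close>, whereas all remaining entries of the new
  list are below \<open>a\<close>, because \<open>b + 1 < a\<close>.\<close>

lemma desc_list_transfer_less:
  assumes "a \<ge> b + 2"
  shows "(desc_list (add_mset (a - 1) (add_mset (b + 1) M)),
    desc_list (add_mset a (add_mset b M))) \<in> lexord {(x, y). x < y}"
proof -
  define H where "H = filter_mset (\<lambda>x. x \<ge> a) M"
  define L where "L = filter_mset (\<lambda>x. \<not> x \<ge> a) M"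
  have M: "M = H + L" unfolding H_def L_def by (rule multiset_partition)
  define N where "N = add_mset (a - 1) (add_mset (b + 1) L)"
  have "add_mset (a - 1) (add_mset (b + 1) M) = H + N" by (simp add: M N_def)
  moreover have "desc_list (H + N) = desc_list H @ desc_list N"
    using assms by (intro desc_list_add) (auto simp: H_def L_def N_def)
  moreover have "add_mset a (add_mset b M) = H + ({#a#} + add_mset b L)" by (simp add: M)
  moreover have "desc_list (H + ({#a#} + add_mset b L)) = desc_list H @ [a] @ desc_list (add_mset b L)"
    using assms
    by (subst desc_list_add; (subst desc_list_add)?) (auto simp: H_def L_def desc_list_def)
  moreover obtain c cs where c: "desc_list N = c # cs"
    by (cases "desc_list N") (auto simp: desc_list_def N_def dest: arg_cong[of _ _ mset])
  have "c \<in># N" using arg_cong[OF c, of set] by (auto simp: desc_list_def)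
  then have "c < a" using assms by (auto simp: N_def L_def)
  with c have "(desc_list N, [a] @ desc_list (add_mset b L)) \<in> lexord {(x, y). x < y}" by simp
  ultimately show ?thesis by (simp only: lexord_append_leftI)
qed

lemma sorted_in_degrees_conv:
  "sorted_in_degrees D = desc_list (image_mset (in_degree D) (mset_set (verts D)))"
  by (simp add: sorted_in_degrees_def desc_list_def)

lemma length_sorted_in_degrees [simp]: "length (sorted_in_degrees D) = card (verts D)"
proof -
  have "length (sorted_in_degrees D) = size (mset (sorted_in_degrees D))" by simp
  also have "\<dots> = card (verts D)" by (simp add: sorted_in_degrees_def del: size_mset)
  finally show ?thesis .
qed

lemma image_mset_two_points:
  assumes "finite V" "s \<in> V" "t \<in> V" "s \<noteq> t"
  shows "image_mset f (mset_set V) =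
    add_mset (f t) (add_mset (f s) (image_mset f (mset_set (V - {s, t}))))"
proof -
  have "V = insert t (insert s (V - {s, t}))" using assms by auto
  then have "mset_set V = add_mset t (add_mset s (mset_set (V - {s, t})))"
    using assms by (metis (no_types, lifting) Diff_iff finite_Diff finite_insert insert_iff mset_set.insert)
  then show ?thesis by simp
qed

text \<open>A difference of exactly 1 makes the transfer a swap of the two values; a larger one is
  covered by \<open>desc_list_transfer_less\<close>. Either difference implies that \<open>s\<close>
  and \<open>t\<close> are distinct.\<close>

lemma sorted_in_degrees_transfer:
  assumes fin: "finite (verts D)" and V: "verts D' = verts D"
    and st: "s \<in> verts D" "t \<in> verts D"
    and deg: "\<And>v. int (in_degree D' v) = int (in_degree D v) + of_bool (v = s) - of_bool (v = t)"
  shows "in_degree D t \<ge> in_degree D s + 2 \<Longrightarrow>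
      (sorted_in_degrees D', sorted_in_degrees D) \<in> lexord {(x, y). x < y}"
    and "in_degree D t = in_degree D s + 1 \<Longrightarrow> sorted_in_degrees D' = sorted_in_degrees D"
proof -
  define R where "R = image_mset (in_degree D) (mset_set (verts D - {s, t}))"
  have R': "image_mset (in_degree D') (mset_set (verts D - {s, t})) = R"
  proof -
    have "in_degree D' v = in_degree D v" if "v \<in> verts D - {s, t}" for v
      using deg[of v] that by simp
    then show ?thesis unfolding R_def using fin by (intro image_mset_cong) auto
  qed
  have D: "sorted_in_degrees D = desc_list (add_mset (in_degree D t) (add_mset (in_degree D s) R))"
    and D': "sorted_in_degrees D' = desc_list (add_mset (in_degree D' t) (add_mset (in_degree D' s) R))"
    if "s \<noteq> t"
    using that fin st R' V
    by (simp_all add: sorted_in_degrees_conv image_mset_two_points[of "verts D" s t] R_def)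
  {
    assume *: "in_degree D t \<ge> in_degree D s + 2"
    then have "s \<noteq> t" by auto
    moreover from this have "in_degree D' t = in_degree D t - 1" "in_degree D' s = in_degree D s + 1"
      using deg[of s] deg[of t] * by auto
    ultimately show "(sorted_in_degrees D', sorted_in_degrees D) \<in> lexord {(x, y). x < y}"
      using desc_list_transfer_less[OF *, of R] D D' by simp
  next
    assume *: "in_degree D t = in_degree D s + 1"
    then have "s \<noteq> t" by auto
    moreover from this have "in_degree D' t = in_degree D s" "in_degree D' s = in_degree D t"
      using deg[of s] deg[of t] * by auto
    ultimately show "sorted_in_degrees D' = sorted_in_degrees D"
      using D D' by (simp add: add_mset_commute)
  }
qed

lemma lexord_less_asym:
  "(xs, ys) \<in> lexord {(a, b::nat). a < b} \<Longrightarrow> (ys, xs) \<notin> lexord {(a, b). a < b}"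
  by (rule lexord_asymmetric) (auto intro!: asymI)

section \<open>Existence and characterization of decreasingly minimal orientations\<close>

context fin_loopless_multigraph
begin

lemma verts_strong_orientation: "D \<in> strong_orientations G \<Longrightarrow> verts D = nodes G"
  by (simp add: strong_orientations_def orientation_of_def)

text \<open>\<open>lexord\<close> is not well-founded on lists of arbitrary length, but
  \<open>lenlex\<close> is, and the two agree here because all sorted vectors have length
  \<open>card (nodes G)\<close>.\<close>

lemma ex_dec_min_strong_orientation:
  assumes "strong_orientations G \<noteq> {}"
  shows "\<exists>D. dec_min_among D (strong_orientations G)"
proof -
  let ?r = "{(a, b::nat). a < b}"
  have "wf (inv_image (lenlex ?r) sorted_in_degrees)"
    by (intro wf_inv_image wf_lenlex wf)
  then obtain D where D: "D \<in> strong_orientations G"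
    and min: "\<And>D'. D' \<in> strong_orientations G \<Longrightarrow> (sorted_in_degrees D', sorted_in_degrees D) \<notin> lenlex ?r"
    using assms unfolding wf_eq_minimal in_inv_image by (metis all_not_in_conv)
  have "sorted_in_degrees D = sorted_in_degrees D' \<or> (sorted_in_degrees D, sorted_in_degrees D') \<in> lexord ?r"
    if "D' \<in> strong_orientations G" for D'
  proof -
    have "\<forall>a b. (a, b) \<in> ?r \<or> a = b \<or> (b, a) \<in> ?r" by auto
    note linear = lexord_linear[OF this, of "sorted_in_degrees D" "sorted_in_degrees D'"]
    show ?thesis
      using min[OF that] linear
        verts_strong_orientation[OF that] verts_strong_orientation[OF D]
      by (auto simp: lenlex_conv lexord_lex)
  qed
  with D show ?thesis by (auto simp: dec_min_among_def)
qed

lemma dec_min_no_transfer: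
  assumes "dec_min_among D (strong_orientations G)" and paths: "two_arc_disjoint_paths D s t"
    and st: "s \<in> nodes G" "t \<in> nodes G"
  shows "in_degree D t < in_degree D s + 2"
proof (rule ccontr)
  assume "\<not> ?thesis"
  then have *: "in_degree D t \<ge> in_degree D s + 2" by simp
  then have "s \<noteq> t" by auto
  have D: "D \<in> strong_orientations G" using assms by (simp add: dec_min_among_def)
  obtain D' where D': "D' \<in> strong_orientations G"
    "\<And>v. int (in_degree D' v) = int (in_degree D v) + of_bool (v = s) - of_bool (v = t)"
    using strong_orientation_reverse_path[OF D paths st \<open>s \<noteq> t\<close>] by blast
  have less: "(sorted_in_degrees D', sorted_in_degrees D) \<in> lexord {(a, b). a < b}"
    using st finite_nodes verts_strong_orientation[OF D] verts_strong_orientation[OF D'(1)]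
    by (intro sorted_in_degrees_transfer(1)[OF _ _ _ _ D'(2) *]) auto
  with lexord_less_asym[OF less] assms(1) D'(1) show False
    by (auto simp: dec_min_among_def)
qed

text \<open>Take a decreasingly minimal \<open>D'\<close> closest to \<open>D\<close>, a node \<open>t\<close> with
  \<open>\<rho>\<^bsub>D\<^esub>(t) > \<rho>\<^bsub>D'\<^esub>(t)\<close> and \<open>\<rho>\<^bsub>D\<^esub>(t)\<close> largest. Exchanging at \<open>t\<close> in \<open>D\<close> gives \<open>s\<close>,
  exchanging at \<open>s\<close> in \<open>D'\<close> gives \<open>t'\<close>, and
  \<open>\<rho>\<^bsub>D\<^esub>(t) - 1 \<le> \<rho>\<^bsub>D\<^esub>(s) \<le> \<rho>\<^bsub>D'\<^esub>(s) - 1 \<le> \<rho>\<^bsub>D'\<^esub>(t') \<le> \<rho>\<^bsub>D\<^esub>(t') - 1 \<le> \<rho>\<^bsub>D\<^esub>(t) - 1\<close>.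
  So moving one unit from \<open>s\<close> to \<open>t'\<close> in \<open>D'\<close> only permutes the in-degrees, but brings \<open>D'\<close>
  closer to \<open>D\<close>.\<close>

lemma dec_min_if_no_transfer:
  assumes D: "D \<in> strong_orientations G"
    and no: "\<And>s t. s \<in> nodes G \<Longrightarrow> t \<in> nodes G \<Longrightarrow> two_arc_disjoint_paths D s t \<Longrightarrow>
      in_degree D t < in_degree D s + 2"
  shows "dec_min_among D (strong_orientations G)"
proof -
  define dist :: "('a, 'b) pre_digraph \<Rightarrow> nat" where
    "dist D' = (\<Sum>v\<in>nodes G. nat \<bar>int (in_degree D' v) - int (in_degree D v)\<bar>)" for D'
  obtain D' where dm: "dec_min_among D' (strong_orientations G)"
    and closest: "\<And>D''. dec_min_among D'' (strong_orientations G) \<Longrightarrow> dist D' \<le> dist D''"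
    using ex_has_least_nat[of "\<lambda>D. dec_min_among D (strong_orientations G)" _ dist]
      ex_dec_min_strong_orientation D by blast
  have D': "D' \<in> strong_orientations G" using dm by (simp add: dec_min_among_def)
  let ?T = "{t \<in> nodes G. in_degree D' t < in_degree D t}"
  have "?T = {}"
  proof (rule ccontr)
    assume ne: "?T \<noteq> {}"
    have "finite ?T" using finite_nodes by simp
    then have fin: "finite (in_degree D ` ?T)" by (rule finite_imageI)
    with ne have "Max (in_degree D ` ?T) \<in> in_degree D ` ?T" by (intro Max_in) auto
    then obtain t where t: "t \<in> ?T" "in_degree D t = Max (in_degree D ` ?T)" by auto
    with fin have t_max: "in_degree D t' \<le> in_degree D t" if "t' \<in> ?T" for t'
      using that by simp
    obtain s where s: "s \<in> nodes G" "in_degree D s < in_degree D' s" "two_arc_disjoint_paths D s t"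
      using strong_orientation_exchange[OF D D', of t] t by auto
    obtain t' where t': "t' \<in> nodes G" "in_degree D' t' < in_degree D t'"
        "two_arc_disjoint_paths D' t' s"
      using strong_orientation_exchange[OF D' D, of s] s by auto
    have "s \<noteq> t'" using s t' by auto
    have "in_degree D t < in_degree D s + 2"
      using t(1) by (intro no[OF s(1) _ s(3)]) simp
    moreover have "in_degree D' s < in_degree D' t' + 2"
      using dec_min_no_transfer[OF dm t'(3)] s t' by auto
    moreover have "in_degree D t' \<le> in_degree D t" using t_max[of t'] t' by simp
    ultimately have eq: "in_degree D' s = in_degree D' t' + 1"
      using s(2) t'(2) by linarith
    obtain D'' where D'': "D'' \<in> strong_orientations G"
      "\<And>v. int (in_degree D'' v) = int (in_degree D' v) + of_bool (v = t') - of_bool (v = s)"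
      using strong_orientation_reverse_path[OF D' t'(3,1) s(1)] \<open>s \<noteq> t'\<close> by blast
    have "sorted_in_degrees D'' = sorted_in_degrees D'"
      using s t' finite_nodes verts_strong_orientation[OF D'] verts_strong_orientation[OF D''(1)]
      by (intro sorted_in_degrees_transfer(2)[OF _ _ _ _ D''(2) eq]) auto
    with dm D'' have "dec_min_among D'' (strong_orientations G)"
      by (simp add: dec_min_among_def)
    then have "dist D' \<le> dist D''" by (rule closest)
    moreover have "dist D'' < dist D'"
      unfolding dist_def
    \<comment> \<open>\<open>D'\<close> exceeds \<open>D\<close> at \<open>s\<close> and falls short
      at \<open>t'\<close>, so the move from \<open>s\<close> to \<open>t'\<close> improves both
      terms and leaves the others alone.\<close>
    proof (rule sum_strict_mono_ex1[OF finite_nodes])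
      show "\<forall>v\<in>nodes G. nat \<bar>int (in_degree D'' v) - int (in_degree D v)\<bar>
          \<le> nat \<bar>int (in_degree D' v) - int (in_degree D v)\<bar>"
        using D''(2) s(2) t'(2) by (auto simp: of_bool_def)
      show "\<exists>v\<in>nodes G. nat \<bar>int (in_degree D'' v) - int (in_degree D v)\<bar>
          < nat \<bar>int (in_degree D' v) - int (in_degree D v)\<bar>"
        using D''(2)[of s] s(1,2) \<open>s \<noteq> t'\<close> by (intro bexI[of _ s]) auto
    qed
    ultimately show False by simp
  qed
  \<comment> \<open>A surplus of \<open>D'\<close> at \<open>v\<close> would, by exchange with the
    roles of \<open>D\<close> and \<open>D'\<close> swapped, produce a node of the empty set
    \<open>?T\<close>.\<close>
  have eq: "in_degree D v = in_degree D' v" if v: "v \<in> nodes G" for v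
  proof (rule ccontr)
    assume "in_degree D v \<noteq> in_degree D' v"
    with \<open>?T = {}\<close> v have "in_degree D v < in_degree D' v" by (auto simp: not_less le_less)
    then obtain t where "t \<in> ?T"
      using strong_orientation_exchange[OF D' D v] by auto
    with \<open>?T = {}\<close> show False by blast
  qed
  have "sorted_in_degrees D = sorted_in_degrees D'"
    using eq finite_nodes verts_strong_orientation[OF D] verts_strong_orientation[OF D']
    by (auto simp: sorted_in_degrees_conv intro!: arg_cong[of _ _ desc_list] image_mset_cong)
  with dm D show ?thesis by (simp add: dec_min_among_def)
qed

end

theorem theorem10p1:
  fixes G :: "('a, 'b) multigraph" and D :: "('a, 'b) pre_digraph"
  assumes "fin_loopless_multigraph G"
    and "strong_orientations G \<noteq> {}"
    and "D \<in> strong_orientations G"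
  shows "dec_min_among D (strong_orientations G) \<longleftrightarrow>
    \<not> (\<exists>s \<in> nodes G. \<exists>t \<in> nodes G.
         in_degree D t \<ge> in_degree D s + 2 \<and> two_arc_disjoint_paths D s t)"
proof -
  interpret fin_loopless_multigraph G by fact
  show ?thesis
    using dec_min_no_transfer[of D] dec_min_if_no_transfer[OF assms(3)] by (auto simp flip: not_less)
qed

end
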